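(* Let $B$ be a set of Cayley permutations and $\operatorname{Av}(B)$ the set of Cayley permutations avoiding every element of $B$. Then there exists a nonnegative integer $k$ with $\operatorname{Av}(B) \subseteq \mathcal{HSB}(k)$ if and only if $B$ contains a permutation from each of the four classes $\mathcal{H}_{I,I}$, $\mathcal{H}_{I,D}$, $\mathcal{H}_{D,I}$, $\mathcal{H}_{D,D}$.
   Context: A Cayley permutation is a word over the positive integers in which every integer between $1$ and its maximum occurs; standardisation replaces the smallest value by $1$, the next smallest by $2$, etc.; $w$ contains $p$ if some subsequence of $w$ standardises to $p$, and avoids it otherwise. Horizontal evolution: a Cayley permutation $\pi=\pi_1\cdots\pi_n$ is built by adding entries from left to right. After the first $t$ entries ($0\le t\le n$) have been placed, the configuration consists of the prefix $\pi_1\cdots\pi_t$ (standardised) together with slots: one repeating slot for each value occurring both in $\pi_1\cdots\pi_t$ and in $\pi_{t+1}\cdots\pi_n$, and one new slot for each gap between consecutive distinct prefix values (including the gap below the minimum and above the maximum; for $t=0$ the single gap) that contains some value of $\pi_{t+1}\cdots\pi_n$ not occurring in the prefix. $\mathcal{HSB}(k)$ is the set of Cayley permutations all of whose configurations in their horizontal evolution have at most $k$ slots. A permutation $\pi$ of size $n+k$ is a horizontal juxtaposition of permutations $\sigma$ (size $n$) and $\tau$ (size $k$) if the length-$n$ prefix of $\pi$ standardises to $\sigma$ and the length-$k$ suffix standardises to $\tau$. For $A,B'\in\{I,D\}$, $\mathcal{H}_{A,B'}$ is the set of permutations that are horizontal juxtapositions of a sequence of type $A$ with a sequence of type $B'$,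 where $I$ means strictly increasing and $D$ strictly decreasing. *)

theory Defs
  imports Main "HOL-Library.Sublist"
begin

text \<open>Words are lists of natural numbers. The empty word is a Cayley permutation (of size 0).\<close>

definition cayley_perm :: "nat list \<Rightarrow> bool" where
  "cayley_perm w \<longleftrightarrow> (\<exists>m. set w = {1..m})"

definition is_perm :: "nat list \<Rightarrow> bool" where
  "is_perm w \<longleftrightarrow> cayley_perm w \<and> distinct w"

definition standardise :: "nat list \<Rightarrow> nat list" where
  "standardise w = map (\<lambda>x. card {y \<in> set w. y \<le> x}) w"

definition contains :: "nat list \<Rightarrow> nat list \<Rightarrow> bool" where
  "contains w p \<longleftrightarrow> (\<exists>u. subseq u w \<and> standardise u = p)"

definition Av :: "nat list set \<Rightarrow> nat list set" where
  "Av B = {w. cayley_perm w \<and> (\<forall>p\<in>B. \<not> contains w p)}"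

text \<open>
  The gaps of a finite set \<open>P\<close> of values, each represented by the set of natural numbers strictly
  inside it. Distinct gaps may be represented by the same set only if both are empty,
  and an empty gap never carries a slot.
\<close>

definition gaps :: "nat set \<Rightarrow> nat set set" where
  "gaps P = (if P = {} then {UNIV}
     else {{..<Min P}, {Max P<..}} \<union>
          {{a<..<b} | a b. a \<in> P \<and> b \<in> P \<and> a < b \<and> {a<..<b} \<inter> P = {}})"

datatype slot = Repeating nat | New "nat set"

text \<open>
  The slots of the configuration of \<open>w\<close> after its first \<open>t\<close> entries. Slots are labelled by the
  original values of \<open>w\<close>; standardising the prefix only relabels them.
\<close>

definition hslots :: "nat list \<Rightarrow> nat \<Rightarrow> slot set" where
  "hslots w t =
     Repeating ` (set (take t w) \<inter> set (drop t w)) \<union>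
     New ` {G \<in> gaps (set (take t w)). \<exists>v \<in> set (drop t w). v \<notin> set (take t w) \<and> v \<in> G}"

definition HSB :: "nat \<Rightarrow> nat list set" where
  "HSB k = {w. cayley_perm w \<and> (\<forall>t \<le> length w. card (hslots w t) \<le> k)}"

definition horizontal_juxtaposition :: "nat list \<Rightarrow> nat list \<Rightarrow> nat list \<Rightarrow> bool" where
  "horizontal_juxtaposition w \<sigma> \<tau> \<longleftrightarrow>
     is_perm w \<and> is_perm \<sigma> \<and> is_perm \<tau> \<and> length w = length \<sigma> + length \<tau> \<and>
     standardise (take (length \<sigma>) w) = \<sigma> \<and> standardise (drop (length \<sigma>) w) = \<tau>"

datatype mono_type = Incr | Decr

fun has_type :: "mono_type \<Rightarrow> nat list \<Rightarrow> bool" where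
  "has_type Incr w \<longleftrightarrow> sorted_wrt (<) w"
| "has_type Decr w \<longleftrightarrow> sorted_wrt (>) w"

definition Hclass :: "mono_type \<Rightarrow> mono_type \<Rightarrow> nat list set" where
  "Hclass X Y = {w. \<exists>\<sigma> \<tau>. has_type X \<sigma> \<and> has_type Y \<tau> \<and> horizontal_juxtaposition w \<sigma> \<tau>}"

end

theory Submission
  imports Defs "HOL-Library.Ramsey"
begin

text \<open>
  The class \<open>Hclass X Y\<close> is closed under containment and has members with arbitrarily many slots,
  so a bound on the slots of \<open>Av B\<close> forces \<open>B\<close> to meet it. Conversely, a configuration with
  many slots yields values \<open>a\<^sub>0 \<le> b\<^sub>0 < a\<^sub>1 \<le> b\<^sub>1 < \<dots>\<close>, each \<open>a\<^sub>i\<close> from the prefix and each \<open>b\<^sub>i\<close>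
  from the suffix. Colouring each pair \<open>i < j\<close> by the relative order of the positions of
  \<open>a\<^sub>i, a\<^sub>j\<close> and of \<open>b\<^sub>i, b\<^sub>j\<close>, Ramsey's theorem gives a long subfamily on which both sequences
  are monotone in position. It contains every sufficiently short member of the class \<open>Hclass X Y\<close>
  of its colour: the value \<open>v\<close> goes to the \<open>v\<close>-th \<open>a\<close> or \<open>b\<close> of the subfamily, according to the side
  of the juxtaposition on which \<open>v\<close> lies.
\<close>

section \<open>Ranks and standardisation\<close>

lemma strict_mono_on_rank:
  fixes S :: "nat set"
  assumes "finite S"
  shows "strict_mono_on S (\<lambda>x. card {y \<in> S. y \<le> x})"
proof (rule strict_mono_onI)
  fix x y assume "x \<in> S" "y \<in> S" "x < y"
  then have "y \<in> {z \<in> S. z \<le> y} - {z \<in> S. z \<le> x}" "{z \<in> S. z \<le> x} \<subseteq> {z \<in> S. z \<le> y}"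
    by auto
  then show "card {z \<in> S. z \<le> x} < card {z \<in> S. z \<le> y}"
    using assms by (intro psubset_card_mono) auto
qed

text \<open>Distinct elements have distinct ranks, so by counting the ranks fill the
  interval.\<close>

lemma rank_image:
  fixes S :: "nat set"
  assumes "finite S"
  shows "(\<lambda>x. card {y \<in> S. y \<le> x}) ` S = {1..card S}"
proof (rule card_subset_eq)
  show "(\<lambda>x. card {y \<in> S. y \<le> x}) ` S \<subseteq> {1..card S}"
  proof
    fix r assume "r \<in> (\<lambda>x. card {y \<in> S. y \<le> x}) ` S"
    then obtain x where x: "x \<in> S" "r = card {y \<in> S. y \<le> x}" by auto
    then have "{y \<in> S. y \<le> x} \<noteq> {}" by blast
    then have "0 < r" using assms x by (simp add: card_gt_0_iff)
    moreover have "r \<le> card S" using x assms by (auto intro: card_mono)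
    ultimately show "r \<in> {1..card S}" by simp
  qed
  have "inj_on (\<lambda>x. card {y \<in> S. y \<le> x}) S"
    using strict_mono_on_rank[OF assms] by (rule strict_mono_on_imp_inj_on)
  then show "card ((\<lambda>x. card {y \<in> S. y \<le> x}) ` S) = card {1..card S}"
    by (simp add: card_image)
qed simp

lemma length_standardise [simp]: "length (standardise w) = length w"
  by (simp add: standardise_def)

lemma cayley_perm_standardise: "cayley_perm (standardise w)"
  unfolding cayley_perm_def standardise_def set_map using rank_image[OF finite_set] by blast

lemma distinct_standardise:
  "distinct w \<Longrightarrow> distinct (standardise w)"
  unfolding standardise_def
  by (simp add: distinct_map strict_mono_on_imp_inj_on[OF strict_mono_on_rank])

lemma is_perm_standardise: "distinct w \<Longrightarrow> is_perm (standardise w)"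
  by (simp add: is_perm_def cayley_perm_standardise distinct_standardise)

lemma standardise_cayley:
  assumes "cayley_perm p"
  shows "standardise p = p"
proof -
  obtain m where m: "set p = {1..m}" using assms by (auto simp: cayley_perm_def)
  have "card {y \<in> set p. y \<le> x} = x" if "x \<in> set p" for x
  proof -
    have "{y \<in> set p. y \<le> x} = {1..x}" using that m by auto
    then show ?thesis by simp
  qed
  then show ?thesis by (simp add: standardise_def map_idI)
qed

text \<open>A rank depends only on relative order. This is what makes an embedded copy
  \<open>map f p\<close> of a permutation standardise back to \<open>p\<close>.\<close>

lemma standardise_map:
  assumes "strict_mono_on (set w) f"
  shows "standardise (map f w) = standardise w"
proof -
  have "card {y \<in> f ` set w. y \<le> f x} = card {y \<in> set w. y \<le> x}" if "x \<in> set w" for x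
  proof -
    have "{y \<in> f ` set w. y \<le> f x} = f ` {y \<in> set w. y \<le> x}"
      using that by (auto simp: strict_mono_on_less_eq[OF assms])
    moreover have "inj_on f {y \<in> set w. y \<le> x}"
      using strict_mono_on_imp_inj_on[OF assms] by (rule inj_on_subset) auto
    ultimately show ?thesis by (simp add: card_image)
  qed
  then show ?thesis by (simp add: standardise_def)
qed

section \<open>Monotone types and juxtaposition classes\<close>

definition prec :: "mono_type \<Rightarrow> nat \<Rightarrow> nat \<Rightarrow> bool" where
  "prec X = (case X of Incr \<Rightarrow> (<) | Decr \<Rightarrow> (>))"

text \<open>Lets general facts on \<open>sorted_wrt\<close> serve both types at once.\<close>

lemma has_type_prec: "has_type X w \<longleftrightarrow> sorted_wrt (prec X) w"
  by (cases X) (auto simp: prec_def)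

lemma prec_standardise:
  "x \<in> set w \<Longrightarrow> y \<in> set w \<Longrightarrow>
    prec X (card {z \<in> set w. z \<le> x}) (card {z \<in> set w. z \<le> y}) \<longleftrightarrow> prec X x y"
  using strict_mono_on_less[OF strict_mono_on_rank[of "set w"]]
  by (cases X) (auto simp: prec_def)

lemma has_type_standardise: "has_type X (standardise w) \<longleftrightarrow> has_type X w"
proof -
  have "sorted_wrt (\<lambda>x y. prec X (card {z \<in> set w. z \<le> x}) (card {z \<in> set w. z \<le> y})) w
      \<longleftrightarrow> sorted_wrt (prec X) w"
    by (intro iffI; erule sorted_wrt_mono_rel[rotated]) (auto simp: prec_standardise)
  then show ?thesis
    by (simp add: has_type_prec standardise_def sorted_wrt_map)
qed

lemma sorted_wrt_subseq: "subseq u w \<Longrightarrow> sorted_wrt R w \<Longrightarrow> sorted_wrt R u"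
proof (induction rule: list_emb.induct)
  case (list_emb_Cons2 x y xs ys)
  have "set xs \<subseteq> set ys"
    using list_emb_Cons2.hyps(2) by (metis subseq_conv_nths set_nths_subset)
  then show ?case using list_emb_Cons2 by auto
qed simp_all

text \<open>Standardising a half keeps its monotone type and turns distinct entries into a
  permutation, so the two witnesses reduce to a cut position.\<close>

lemma Hclass_iff:
  "w \<in> Hclass X Y \<longleftrightarrow>
    is_perm w \<and> (\<exists>n \<le> length w. has_type X (take n w) \<and> has_type Y (drop n w))"
proof
  assume "w \<in> Hclass X Y"
  then obtain s t where st: "has_type X s" "has_type Y t" "is_perm w"
    "length w = length s + length t" "standardise (take (length s) w) = s"
    "standardise (drop (length s) w) = t"
    by (auto simp: Hclass_def horizontal_juxtaposition_def)
  then have "has_type X (take (length s) w)" "has_type Y (drop (length s) w)"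
    by (metis has_type_standardise)+
  with st show "is_perm w \<and> (\<exists>n \<le> length w. has_type X (take n w) \<and> has_type Y (drop n w))"
    by (metis le_add1)
next
  assume "is_perm w \<and> (\<exists>n \<le> length w. has_type X (take n w) \<and> has_type Y (drop n w))"
  then obtain n where n: "n \<le> length w" "has_type X (take n w)" "has_type Y (drop n w)"
    and w: "is_perm w" by blast
  have "distinct w" using w by (simp add: is_perm_def)
  then have "horizontal_juxtaposition w (standardise (take n w)) (standardise (drop n w))"
    using n w by (simp add: horizontal_juxtaposition_def is_perm_standardise min_def)
  then show "w \<in> Hclass X Y"
    using n has_type_standardise unfolding Hclass_def by blast
qed

text \<open>A subsequence of \<open>w\<close> splits at the cut into subsequences of the two
  monotone halves, and these inherit monotonicity.\<close>

lemma Hclass_contains: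
  assumes w: "w \<in> Hclass X Y" and "contains w p"
  shows "p \<in> Hclass X Y"
proof -
  obtain u where u: "subseq u w" "standardise u = p"
    using assms(2) by (auto simp: contains_def)
  obtain n where n: "has_type X (take n w)" "has_type Y (drop n w)" and w: "is_perm w"
    using w by (auto simp: Hclass_iff)
  have "subseq u (take n w @ drop n w)" using u by simp
  then obtain u1 u2 where u12: "u = u1 @ u2" "subseq u1 (take n w)" "subseq u2 (drop n w)"
    by (rule subseq_appendE)
  have types: "has_type X u1" "has_type Y u2"
    using n u12 by (auto simp: has_type_prec intro: sorted_wrt_subseq)
  have "distinct u" using u w by (auto simp: is_perm_def subseq_conv_nths intro: distinct_nthsI)
  then have "is_perm p" using u is_perm_standardise by blast
  \<comment> \<open>Ranks are taken in all of \<open>u\<close>, not in each half separately; they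
    still preserve the order within a half.\<close>
  let ?r = "\<lambda>x. card {y \<in> set u. y \<le> x}"
  have p: "p = map ?r u1 @ map ?r u2" using u u12 by (simp add: standardise_def)
  have "sorted_wrt (prec X) (map ?r u1)" "sorted_wrt (prec Y) (map ?r u2)"
    using types prec_standardise[of _ u] u12
    by (auto simp: has_type_prec sorted_wrt_map elim!: sorted_wrt_mono_rel[rotated])
  then have "has_type X (take (length u1) p)" "has_type Y (drop (length u1) p)"
    by (simp_all add: p has_type_prec)
  then show ?thesis
    using \<open>is_perm p\<close> unfolding Hclass_iff by (intro conjI exI[of _ "length u1"]) (auto simp: p)
qed

section \<open>Necessity: members of each class with too many slots\<close>

lemma finite_gaps:
  assumes "finite P"
  shows "finite (gaps P)"
proof -
  have "finite ({UNIV, {..<Min P}, {Max P<..}} \<union> (\<lambda>(a, b). {a<..<b}) ` (P \<times> P))"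
    using assms by simp
  moreover have "gaps P \<subseteq> {UNIV, {..<Min P}, {Max P<..}} \<union> (\<lambda>(a, b). {a<..<b}) ` (P \<times> P)"
    unfolding gaps_def by auto
  ultimately show ?thesis by (rule rev_finite_subset)
qed

text \<open>Infinite sets have \<open>card\<close> 0 by convention, so a lower bound on the number
  of slots needs finiteness.\<close>

lemma finite_hslots: "finite (hslots w t)"
  by (simp add: hslots_def finite_gaps)

text \<open>The prefix consists of the odd values and the suffix of the even ones, so that each even value
  lies in a gap of its own.\<close>

definition zigzag :: "mono_type \<Rightarrow> mono_type \<Rightarrow> nat \<Rightarrow> nat list" where
  "zigzag X Y m =
     (case X of Incr \<Rightarrow> id | Decr \<Rightarrow> rev) (map (\<lambda>i. 2 * i + 1) [0..<m]) @
     (case Y of Incr \<Rightarrow> id | Decr \<Rightarrow> rev) (map (\<lambda>i. 2 * i + 2) [0..<m])"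

lemma zigzag_parts:
  "set (take m (zigzag X Y m)) = (\<lambda>i. 2 * i + 1) ` {..<m}"
  "set (drop m (zigzag X Y m)) = (\<lambda>i. 2 * i + 2) ` {..<m}"
  "has_type X (take m (zigzag X Y m))" "has_type Y (drop m (zigzag X Y m))"
  "length (zigzag X Y m) = 2 * m"
  by (cases X; cases Y; simp add: zigzag_def sorted_wrt_rev sorted_wrt_map atLeast0LessThan)+

lemma set_zigzag: "set (zigzag X Y m) = {1..2 * m}"
proof -
  have "set (zigzag X Y m) = (\<lambda>i. 2 * i + 1) ` {..<m} \<union> (\<lambda>i. 2 * i + 2) ` {..<m}"
    by (cases X; cases Y) (auto simp: zigzag_def)
  also have "\<dots> = {1..2 * m}"
  proof (intro equalityI subsetI)
    fix x assume x: "x \<in> {1..2 * m}"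
    show "x \<in> (\<lambda>i. 2 * i + 1) ` {..<m} \<union> (\<lambda>i. 2 * i + 2) ` {..<m}"
    proof (cases "even x")
      case True
      then have "x = 2 * (x div 2 - 1) + 2" "x div 2 - 1 < m" using x by auto
      then show ?thesis by blast
    next
      case False
      then have "x = 2 * (x div 2) + 1" by simp
      moreover from this have "x div 2 < m" using x by (simp only: atLeastAtMost_iff) linarith
      ultimately show ?thesis by blast
    qed
  qed auto
  finally show ?thesis .
qed

lemma zigzag_Hclass: "zigzag X Y m \<in> Hclass X Y"
proof -
  have "distinct (zigzag X Y m)"
    \<comment> \<open>The word has as many entries as values, so none is repeated.\<close>
    by (rule card_distinct) (simp add: set_zigzag zigzag_parts)
  then have "is_perm (zigzag X Y m)"
    unfolding is_perm_def cayley_perm_def using set_zigzag by blast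
  then show ?thesis
    unfolding Hclass_iff using zigzag_parts by (intro conjI exI[of _ m]) auto
qed

text \<open>The \<open>k + 2\<close> odd values of the prefix have \<open>k + 1\<close> gaps between
  neighbours, each holding an even value of the suffix; these new slots alone exceed
  \<open>k\<close>.\<close>

lemma zigzag_not_HSB: "zigzag X Y (k + 2) \<notin> HSB k"
proof
  let ?w = "zigzag X Y (k + 2)" and ?g = "\<lambda>i::nat. {2 * i + 1<..<2 * i + 3}"
  let ?P = "set (take (k + 2) ?w)"
  assume "?w \<in> HSB k"
  then have le: "card (hslots ?w (k + 2)) \<le> k"
    by (auto simp: HSB_def zigzag_parts)
  have P: "?P = (\<lambda>i. 2 * i + 1) ` {..<k + 2}"
    by (rule zigzag_parts)
  have "(\<lambda>i. New (?g i)) ` {..k} \<subseteq> hslots ?w (k + 2)"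
  proof (rule image_subsetI)
    fix i assume i: "i \<in> {..k}"
    have "2 * i + 1 \<in> ?P" unfolding P using i by auto
    moreover have "2 * i + 3 \<in> ?P"
      unfolding P using i by (intro image_eqI[of _ _ "Suc i"]) auto
    moreover have "?g i \<inter> ?P = {}" unfolding P by (auto; presburger)
    ultimately have "?g i \<in> gaps ?P" unfolding gaps_def by (auto 0 4)
    moreover have "2 * i + 2 \<in> set (drop (k + 2) ?w)"
      unfolding zigzag_parts using i by auto
    moreover have "2 * i + 2 \<notin> ?P" unfolding P by (auto; presburger)
    moreover have "2 * i + 2 \<in> ?g i" by simp
    ultimately show "New (?g i) \<in> hslots ?w (k + 2)"
      unfolding hslots_def by blast
  qed
  then have "card ((\<lambda>i. New (?g i)) ` {..k}) \<le> card (hslots ?w (k + 2))"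
    by (rule card_mono[OF finite_hslots])
  moreover have "inj_on (\<lambda>i. New (?g i)) {..k}"
  proof (rule inj_onI)
    fix i j assume "New (?g i) = New (?g j)"
    \<comment> \<open>The midpoint of one of these gaps lies in no other, so equal gaps have equal
      indices.\<close>
    then have "2 * i + 2 \<in> ?g j" using greaterThanLessThan_iff[of "2 * i + 2"] by fastforce
    then show "i = j" by auto
  qed
  ultimately show False using le by (simp add: card_image)
qed

text \<open>The zigzag escapes \<open>HSB k\<close> and hence \<open>Av B\<close>, so it contains an
  element of \<open>B\<close>; closure under containment puts that element in the class.\<close>

lemma Av_bounded_imp_Hclass:
  assumes "Av B \<subseteq> HSB k"
  shows "\<exists>p\<in>B. p \<in> Hclass X Y"
proof -
  let ?w = "zigzag X Y (k + 2)"
  have "?w \<notin> Av B" using assms zigzag_not_HSB by blast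
  moreover have "cayley_perm ?w" using zigzag_Hclass by (auto simp: Hclass_iff is_perm_def)
  ultimately show ?thesis
    using Hclass_contains[OF zigzag_Hclass] unfolding Av_def by blast
qed

section \<open>Sufficiency: interleaved values from many slots\<close>

definition interleaved :: "nat \<Rightarrow> nat set \<Rightarrow> nat set \<Rightarrow> (nat \<Rightarrow> nat) \<Rightarrow> (nat \<Rightarrow> nat) \<Rightarrow> bool" where
  "interleaved m P Q a b \<longleftrightarrow>
     (\<forall>i<m. a i \<in> P \<and> b i \<in> Q \<and> a i \<le> b i) \<and> (\<forall>i j. i < j \<longrightarrow> j < m \<longrightarrow> b i < a j)"

text \<open>Points outside \<open>P\<close> with no element of \<open>P\<close> between them compare
  alike with all of \<open>P\<close>, and these comparisons determine the gap.\<close>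

lemma gap_unique:
  assumes "finite P" "G \<in> gaps P" "H \<in> gaps P" "u \<in> G" "v \<in> H" "u \<notin> P" "v \<notin> P"
    and "u \<le> v" "\<And>x. x \<in> P \<Longrightarrow> u < x \<Longrightarrow> x < v \<Longrightarrow> False"
  shows "G = H"
proof (cases "P = {}")
  case True
  then show ?thesis using assms by (simp add: gaps_def)
next
  case False
  have below: "x < v \<longleftrightarrow> x < u" if "x \<in> P" for x
    using assms that by (metis le_less_trans linorder_cases not_le)
  have mem: "Min P \<in> P" "Max P \<in> P" using False assms by auto
  have bnd: "Min P \<le> x" "x \<le> Max P" if "x \<in> P" for x using that assms by auto
  \<comment> \<open>A gap is recovered from a single point \<open>z\<close> of it: it holds exactly
    the points outside \<open>P\<close> that have the same elements of \<open>P\<close> below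
    them.\<close>
  have G: "G = {y. \<forall>x\<in>P. x \<noteq> y \<and> (x < y \<longleftrightarrow> x < z)}"
    if "G \<in> gaps P" "z \<in> G" "z \<notin> P" for G z
  proof -
    consider "G = {..<Min P}" | "G = {Max P<..}"
      | a b where "G = {a<..<b}" "a \<in> P" "b \<in> P" "{a<..<b} \<inter> P = {}"
      using \<open>G \<in> gaps P\<close> False unfolding gaps_def by auto
    then show ?thesis
    proof cases
      case 1
      show ?thesis
      proof (intro set_eqI iffI)
        fix y assume "y \<in> G"
        then show "y \<in> {y. \<forall>x\<in>P. x \<noteq> y \<and> (x < y \<longleftrightarrow> x < z)}"
          using 1 that(2) bnd(1) by fastforce
      next
        fix y assume "y \<in> {y. \<forall>x\<in>P. x \<noteq> y \<and> (x < y \<longleftrightarrow> x < z)}"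
        then have "Min P \<noteq> y \<and> (Min P < y \<longleftrightarrow> Min P < z)" using mem by blast
        then show "y \<in> G" using 1 that(2) by simp
      qed
    next
      case 2
      show ?thesis
      proof (intro set_eqI iffI)
        fix y assume "y \<in> G"
        then show "y \<in> {y. \<forall>x\<in>P. x \<noteq> y \<and> (x < y \<longleftrightarrow> x < z)}"
          using 2 that(2) bnd(2) by fastforce
      next
        fix y assume "y \<in> {y. \<forall>x\<in>P. x \<noteq> y \<and> (x < y \<longleftrightarrow> x < z)}"
        then have "Max P \<noteq> y \<and> (Max P < y \<longleftrightarrow> Max P < z)" using mem by blast
        then show "y \<in> G" using 2 that(2) by simp
      qed
    next
      case 3
      have sep: "x \<le> a \<or> b \<le> x" if "x \<in> P" for x
        using that 3(4) by (cases "x \<in> {a<..<b}") auto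
      show ?thesis
      proof (intro set_eqI iffI)
        fix y assume "y \<in> G"
        then show "y \<in> {y. \<forall>x\<in>P. x \<noteq> y \<and> (x < y \<longleftrightarrow> x < z)}"
          using 3(1) that(2) sep by fastforce
      next
        fix y assume "y \<in> {y. \<forall>x\<in>P. x \<noteq> y \<and> (x < y \<longleftrightarrow> x < z)}"
        then have "(a < y \<longleftrightarrow> a < z) \<and> b \<noteq> y \<and> (b < y \<longleftrightarrow> b < z)" using 3(2,3) by blast
        then show "y \<in> G" using 3(1) that(2) by simp
      qed
    qed
  qed
  have "G = {y. \<forall>x\<in>P. x \<noteq> y \<and> (x < y \<longleftrightarrow> x < u)}"
    using assms(2,4,6) by (rule G)
  also have "\<dots> = {y. \<forall>x\<in>P. x \<noteq> y \<and> (x < y \<longleftrightarrow> x < v)}"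
    using below by blast
  also have "\<dots> = H"
    using assms(3,5,7) by (rule G[symmetric])
  finally show ?thesis .
qed

text \<open>One of the two kinds of slot is frequent. Repeating slots give common values directly;
  new slots give unseen suffix values, and a prefix value separates any two of these.\<close>

lemma many_slots_interleaved:
  assumes "card (hslots w t) > 2 * m"
  shows "\<exists>a b. interleaved m (set (take t w)) (set (drop t w)) a b"
proof -
  define P Q where "P = set (take t w)" and "Q = set (drop t w)"
  define N where "N = {G \<in> gaps P. \<exists>v\<in>Q. v \<notin> P \<and> v \<in> G}"
  have fin: "finite P" "finite Q" by (simp_all add: P_def Q_def)
  have "hslots w t = Repeating ` (P \<inter> Q) \<union> New ` N"
    by (simp add: hslots_def P_def Q_def N_def)
  then have "card (hslots w t) \<le> card (P \<inter> Q) + card N"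
    using fin by (metis card_Un_le card_image inj_onI slot.inject)
  \<comment> \<open>New slots need one more than \<open>m\<close>, because \<open>m + 1\<close>
    chosen values have \<open>m\<close> separators between neighbours.\<close>
  then consider (rep) "card (P \<inter> Q) \<ge> m" | (new) "card N \<ge> Suc m"
    using assms by linarith
  then have "\<exists>a b. interleaved m P Q a b"
  proof cases
    case rep
    define s where "s = sorted_list_of_set (P \<inter> Q)"
    have s: "set s = P \<inter> Q" "sorted_wrt (<) s" "length s \<ge> m"
      using fin rep by (simp_all add: s_def)
    \<comment> \<open>A repeated value plays both roles, which is why \<open>interleaved\<close> has
      the weak inequality \<open>a i \<le> b i\<close>.\<close>
    have "interleaved m P Q ((!) s) ((!) s)"
      unfolding interleaved_def
      using s by (metis IntE nth_mem sorted_wrt_iff_nth_less order.strict_trans2 order_refl)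
    then show ?thesis by blast
  next
    case new
    have "\<forall>G\<in>N. \<exists>x. x \<in> Q \<and> x \<notin> P \<and> x \<in> G" by (auto simp: N_def)
    then obtain v where "\<forall>G\<in>N. v G \<in> Q \<and> v G \<notin> P \<and> v G \<in> G" by metis
    then have v: "v G \<in> Q" "v G \<notin> P" "v G \<in> G" if "G \<in> N" for G using that by blast+
    \<comment> \<open>Without a prefix value in between, the two chosen values would lie in the same
      gap.\<close>
    have sep: "\<exists>x\<in>P. v G < x \<and> x < v H" if "G \<in> N" "H \<in> N" "v G < v H" for G H
    proof (rule ccontr)
      assume "\<not> ?thesis"
      then have "G = H"
        using that v by (intro gap_unique[OF fin(1), of G H "v G" "v H"]) (auto simp: N_def)
      then show False using that by simp
    qed
    have inj: "inj_on v N"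
    proof (rule inj_onI)
      fix G H assume *: "G \<in> N" "H \<in> N" "v G = v H"
      then show "G = H"
        using v[OF *(1)] v[OF *(2)] by (intro gap_unique[OF fin(1), of G H "v G" "v H"]) (auto simp: N_def)
    qed
    have "finite N" using finite_gaps[OF fin(1)] by (simp add: N_def)
    define s where "s = sorted_list_of_set (v ` N)"
    have s: "set s = v ` N" "sorted_wrt (<) s" "length s \<ge> Suc m"
      using \<open>finite N\<close> new inj by (simp_all add: s_def card_image)
    have "\<exists>x\<in>P. s ! i < x \<and> x < s ! Suc i" if "i < m" for i
    proof -
      have "s ! i \<in> v ` N" "s ! Suc i \<in> v ` N"
        using s(3) that by (simp_all flip: s(1))
      moreover have "s ! i < s ! Suc i"
        using s that by (simp add: sorted_wrt_iff_nth_less)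
      ultimately show ?thesis using sep by (metis imageE)
    qed
    then obtain a where a: "a i \<in> P" "s ! i < a i" "a i < s ! Suc i" if "i < m" for i
      by metis
    \<comment> \<open>The shift pairs each separator \<open>a i\<close> with the chosen value just
      above it; the least chosen value merely lies below all separators.\<close>
    have "interleaved m P Q a (\<lambda>i. s ! Suc i)"
      unfolding interleaved_def
    proof (intro conjI allI impI)
      fix i assume i: "i < m"
      show "a i \<in> P" "a i \<le> s ! Suc i" using a[OF i] by simp_all
      have "s ! Suc i \<in> v ` N" using s(3) i by (simp flip: s(1))
      then show "s ! Suc i \<in> Q" using v by auto
    next
      fix i j assume ij: "i < j" "j < m"
      have "s ! Suc i \<le> s ! j"
        using s ij by (cases "Suc i = j") (auto simp: sorted_wrt_iff_nth_less intro!: less_imp_le)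
      then show "s ! Suc i < a j" using a ij by (meson le_less_trans)
    qed
    then show ?thesis by blast
  qed
  then show ?thesis by (simp add: P_def Q_def)
qed

section \<open>Embedding a short member of a class\<close>

lemma subseq_map_nth:
  "sorted_wrt (<) js \<Longrightarrow> \<forall>j\<in>set js. j < length xs \<Longrightarrow> subseq (map ((!) xs) js) xs"
proof (induction js arbitrary: xs rule: rev_induct)
  case (snoc j js)
  \<comment> \<open>Cutting \<open>xs\<close> at the last index \<open>j\<close> keeps all earlier
    indices within \<open>take j xs\<close>, while \<open>xs ! j\<close> heads
    \<open>drop j xs\<close>.\<close>
  have "subseq (map ((!) (take j xs)) js) (take j xs)"
    using snoc by (intro snoc.IH) (auto simp: sorted_wrt_append)
  moreover have "map ((!) (take j xs)) js = map ((!) xs) js"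
    using snoc by (auto simp: sorted_wrt_append)
  moreover have "subseq [xs ! j] (drop j xs)"
    using snoc by (simp add: subseq_singleton_left Cons_nth_drop_Suc[symmetric])
  ultimately have "subseq (map ((!) xs) js @ [xs ! j]) (take j xs @ drop j xs)"
    by (metis list_emb_append_mono)
  then show ?case by simp
qed simp

text \<open>Two reversals cancel: for \<open>Decr\<close> both the list of indices and their
  positions run backwards, so the entries are met from left to right for either type.\<close>

lemma subseq_of_positions:
  assumes "sorted_wrt (prec X) ks" and "\<And>k. k \<in> set ks \<Longrightarrow> pos k < length xs \<and> xs ! pos k = f k"
    and "\<And>k l. k \<in> set ks \<Longrightarrow> l \<in> set ks \<Longrightarrow> k < l \<Longrightarrow> if X = Incr then pos k < pos l else pos l < pos k"
  shows "subseq (map f ks) xs"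
proof -
  have "sorted_wrt (<) (map pos ks)"
    unfolding sorted_wrt_map
    using assms(1) by (rule sorted_wrt_mono_rel[rotated]) (use assms(3) in \<open>cases X; force simp: prec_def\<close>)
  then have "subseq (map ((!) xs) (map pos ks)) xs"
    using assms(2) by (intro subseq_map_nth) auto
  moreover have "map ((!) xs) (map pos ks) = map f ks"
    using assms(2) by auto
  ultimately show ?thesis by metis
qed

text \<open>The relabelling of \<open>p\<close> has to respect values and positions: the
  interleaving takes care of the former, the types \<open>X\<close> and \<open>Y\<close> of the
  positions over \<open>H\<close> of the latter.\<close>

lemma interleaved_contains:
  assumes il: "interleaved m (set (take t w)) (set (drop t w)) a b"
    and pa: "\<And>i. i < m \<Longrightarrow> pa i < length (take t w) \<and> take t w ! pa i = a i"
    and pb: "\<And>i. i < m \<Longrightarrow> pb i < length (drop t w) \<and> drop t w ! pb i = b i"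
    and H: "H \<subseteq> {..<m}" "card H = N"
    and X: "\<And>i j. i \<in> H \<Longrightarrow> j \<in> H \<Longrightarrow> i < j \<Longrightarrow> if X = Incr then pa i < pa j else pa j < pa i"
    and Y: "\<And>i j. i \<in> H \<Longrightarrow> j \<in> H \<Longrightarrow> i < j \<Longrightarrow> if Y = Incr then pb i < pb j else pb j < pb i"
    and p: "p \<in> Hclass X Y" "length p \<le> N"
  shows "contains w p"
proof -
  obtain n where n: "has_type X (take n p)" "has_type Y (drop n p)" and perm: "is_perm p"
    using p by (auto simp: Hclass_iff)
  obtain M where M: "set p = {1..M}" using perm by (auto simp: is_perm_def cayley_perm_def)
  \<comment> \<open>So \<open>H\<close> has an index for each value of \<open>p\<close>.\<close>
  have "M \<le> N" using M p(2) card_length[of p] by simp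
  have "finite H" using H finite_subset by blast
  \<comment> \<open>Values of \<open>p\<close> start at 1 and list indices at 0, hence
    \<open>v - 1\<close>.\<close>
  define e where "e v = sorted_list_of_set H ! (v - 1)" for v
  have eH: "e v \<in> H" if "v \<in> set p" for v
    using that M \<open>M \<le> N\<close> H \<open>finite H\<close>
    by (metis One_nat_def Suc_le_eq Suc_pred atLeastAtMost_iff e_def le_trans
        length_sorted_list_of_set nth_mem set_sorted_list_of_set)
  have e_less: "e u < e v" if "u \<in> set p" "v \<in> set p" "u < v" for u v
    unfolding e_def using that M \<open>M \<le> N\<close> H
    by (intro sorted_wrt_nth_less[OF strict_sorted_list_of_set]) auto
  define f where "f v = (if v \<in> set (take n p) then a (e v) else b (e v))" for v
  have f_mono: "strict_mono_on (set p) f"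
  proof (rule strict_mono_onI)
    fix u v assume uv: "u \<in> set p" "v \<in> set p" "u < v"
    have "e u < m" "e v < m" using eH uv H by auto
    \<comment> \<open>This chain settles all four combinations of sides on which \<open>u\<close>
      and \<open>v\<close> may lie.\<close>
    then have "a (e u) \<le> b (e u)" "b (e u) < a (e v)" "a (e v) \<le> b (e v)"
      using il e_less[OF uv] by (auto simp: interleaved_def)
    then show "f u < f v" by (auto simp: f_def)
  qed
  \<comment> \<open>Entries of \<open>p\<close> are distinct, so \<open>f\<close> takes its
    \<open>b\<close> branch on the whole second half.\<close>
  have disj: "v \<notin> set (take n p)" if "v \<in> set (drop n p)" for v
    using perm that unfolding is_perm_def by (metis append_take_drop_id disjoint_iff distinct_append)
  have sub: "set (take n p) \<subseteq> set p" "set (drop n p) \<subseteq> set p"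
    by (rule set_take_subset set_drop_subset)+
  have "subseq (map f (take n p)) (take t w)"
  proof (rule subseq_of_positions[where pos = "pa \<circ> e" and X = X])
    show "sorted_wrt (prec X) (take n p)" using n by (simp add: has_type_prec)
    show "(pa \<circ> e) k < length (take t w) \<and> take t w ! (pa \<circ> e) k = f k"
      if "k \<in> set (take n p)" for k
      using pa[of "e k"] that sub H eH[of k] by (auto simp: f_def)
    show "if X = Incr then (pa \<circ> e) k < (pa \<circ> e) l else (pa \<circ> e) l < (pa \<circ> e) k"
      if "k \<in> set (take n p)" "l \<in> set (take n p)" "k < l" for k l
      using X[OF eH eH e_less] that sub by (simp add: subset_iff)
  qed
  moreover have "subseq (map f (drop n p)) (drop t w)"
  proof (rule subseq_of_positions[where pos = "pb \<circ> e" and X = Y])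
    show "sorted_wrt (prec Y) (drop n p)" using n by (simp add: has_type_prec)
    show "(pb \<circ> e) k < length (drop t w) \<and> drop t w ! (pb \<circ> e) k = f k"
      if "k \<in> set (drop n p)" for k
      using pb[of "e k"] that sub H eH[of k] disj[of k] by (auto simp: f_def)
    show "if Y = Incr then (pb \<circ> e) k < (pb \<circ> e) l else (pb \<circ> e) l < (pb \<circ> e) k"
      if "k \<in> set (drop n p)" "l \<in> set (drop n p)" "k < l" for k l
      using Y[OF eH eH e_less] that sub by (simp add: subset_iff)
  qed
  ultimately have "subseq (map f p) w"
    by (metis append_take_drop_id list_emb_append_mono map_append)
  moreover have "standardise (map f p) = p"
    using perm standardise_map[OF f_mono] by (simp add: standardise_cayley is_perm_def)
  ultimately show ?thesis unfolding contains_def by blast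
qed

section \<open>Ramsey's theorem and the equivalence\<close>

lemma ramsey_two_relations:
  fixes N :: nat
  shows "\<exists>m::nat. \<forall>A B. \<exists>H (\<alpha>::bool) (\<beta>::bool). H \<subseteq> {..<m} \<and> card H = N \<and>
    (\<forall>i\<in>H. \<forall>j\<in>H. i < j \<longrightarrow> A i j = \<alpha> \<and> B i j = \<beta>)"
proof -
  \<comment> \<open>One colour for each pair of truth values. The number \<open>m\<close> depends on
    \<open>N\<close> alone and is fixed before the relations, since one bound on slots has to serve
    all words.\<close>
  obtain m :: nat where m: "partn_lst {..<m} [N, N, N, N] 2"
    using ramsey_full by blast
  show ?thesis
  proof (intro exI[of _ m] allI)
    fix A B :: "nat \<Rightarrow> nat \<Rightarrow> bool"
    \<comment> \<open>The truth values of \<open>A\<close> and \<open>B\<close> are the binary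
      digits of the colour; \<open>Min\<close> and \<open>Max\<close> recover the order of an
      unordered pair.\<close>
    define f :: "nat set \<Rightarrow> nat" where
      "f S = of_bool (A (Min S) (Max S)) + 2 * of_bool (B (Min S) (Max S))" for S
    have "f \<in> nsets {..<m} 2 \<rightarrow> {..<4}" by (auto simp: f_def)
    with m obtain c H where c: "c < 4" and H: "H \<in> nsets {..<m} ([N, N, N, N] ! c)"
      and mono: "f ` nsets H 2 \<subseteq> {c}"
      by (rule partn_lstE) (auto simp: numeral_eq_Suc)
    have "[N, N, N, N] ! c = N" using c by (simp add: less_Suc_eq numeral_eq_Suc) auto
    then have "H \<subseteq> {..<m}" "card H = N" using H by (auto simp: nsets_def)
    \<comment> \<open>Reads the digits back: parity of \<open>c\<close> gives \<open>A\<close>, and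
      \<open>c \<ge> 2\<close> gives \<open>B\<close>.\<close>
    moreover have "A i j = odd c \<and> B i j = (c \<ge> 2)" if "i \<in> H" "j \<in> H" "i < j" for i j
    proof -
      have "{i, j} \<in> nsets H 2" using that by (auto simp: nsets_def)
      then have "f {i, j} = c" using mono by blast
      moreover have "Min {i, j} = i" "Max {i, j} = j" using that by auto
      ultimately have "c = of_bool (A i j) + 2 * of_bool (B i j)" unfolding f_def by simp
      then show ?thesis by (cases "A i j"; cases "B i j") auto
    qed
    ultimately show "\<exists>H (\<alpha>::bool) (\<beta>::bool). H \<subseteq> {..<m} \<and> card H = N \<and>
        (\<forall>i\<in>H. \<forall>j\<in>H. i < j \<longrightarrow> A i j = \<alpha> \<and> B i j = \<beta>)"
      by (intro exI[of _ H] exI[of _ "odd c"] exI[of _ "2 \<le> c"]) simp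
  qed
qed

lemma Hclass_imp_Av_bounded:
  assumes "\<And>X Y. \<exists>p\<in>B. p \<in> Hclass X Y"
  shows "\<exists>k. Av B \<subseteq> HSB k"
proof -
  obtain p where p: "p X Y \<in> B" "p X Y \<in> Hclass X Y" for X Y
    using assms by metis
  \<comment> \<open>The colour that Ramsey's theorem yields depends on the word, so \<open>N\<close>
    bounds the lengths of all four chosen permutations.\<close>
  define N where "N = length (p Incr Incr) + length (p Incr Decr)
    + length (p Decr Incr) + length (p Decr Decr)"
  have N: "length (p X Y) \<le> N" for X Y
    by (cases X; cases Y) (auto simp: N_def)
  obtain m :: nat where m: "\<forall>A B. \<exists>H (\<alpha>::bool) (\<beta>::bool). H \<subseteq> {..<m} \<and> card H = N \<and>
      (\<forall>i\<in>H. \<forall>j\<in>H. i < j \<longrightarrow> A i j = \<alpha> \<and> B i j = \<beta>)"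
    using ramsey_two_relations[of N] ..
  have "w \<in> HSB (2 * m)" if w: "w \<in> Av B" for w
  proof (rule ccontr)
    assume "w \<notin> HSB (2 * m)"
    moreover have "cayley_perm w" using w by (simp add: Av_def)
    ultimately obtain t where "card (hslots w t) > 2 * m"
      by (auto simp: HSB_def not_le)
    then obtain a b where il: "interleaved m (set (take t w)) (set (drop t w)) a b"
      using many_slots_interleaved by blast
    have "\<forall>i<m. \<exists>k. k < length (take t w) \<and> take t w ! k = a i"
      using il unfolding interleaved_def in_set_conv_nth by blast
    then obtain pa where pa: "pa i < length (take t w) \<and> take t w ! pa i = a i" if "i < m" for i
      by metis
    have "\<forall>i<m. \<exists>k. k < length (drop t w) \<and> drop t w ! k = b i"
      using il unfolding interleaved_def in_set_conv_nth by blast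
    then obtain pb where pb: "pb i < length (drop t w) \<and> drop t w ! pb i = b i" if "i < m" for i
      by metis
    have "\<exists>H \<alpha> \<beta>. H \<subseteq> {..<m} \<and> card H = N \<and>
        (\<forall>i\<in>H. \<forall>j\<in>H. i < j \<longrightarrow> (pa i < pa j) = \<alpha> \<and> (pb i < pb j) = \<beta>)"
      by (rule m[rule_format])
    then obtain H \<alpha> \<beta> where H: "H \<subseteq> {..<m}" "card H = N"
      and col: "\<forall>i\<in>H. \<forall>j\<in>H. i < j \<longrightarrow> (pa i < pa j) = \<alpha> \<and> (pb i < pb j) = \<beta>"
      by (elim exE conjE)
    note mono = col[rule_format]
    \<comment> \<open>Different values occupy different positions, so a failing
      \<open>pa i < pa j\<close> means \<open>pa j < pa i\<close>, as type \<open>Decr\<close>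
      demands; likewise for \<open>pb\<close>.\<close>
    have neq: "pa i \<noteq> pa j" "pb i \<noteq> pb j" if "i \<in> H" "j \<in> H" "i < j" for i j
    proof -
      have "i < m" "j < m" using that H by auto
      then have "a i \<le> b i" "b i < a j" "a j \<le> b j"
        using il that by (simp_all add: interleaved_def)
      then have "a i \<noteq> a j" "b i \<noteq> b j" by linarith+
      then show "pa i \<noteq> pa j" "pb i \<noteq> pb j"
        using pa[of i] pa[of j] pb[of i] pb[of j] \<open>i < m\<close> \<open>j < m\<close> by auto
    qed
    define X where "X = (if \<alpha> then Incr else Decr)"
    define Y where "Y = (if \<beta> then Incr else Decr)"
    have "contains w (p X Y)"
    proof (rule interleaved_contains[OF il pa pb H _ _ p(2) N])
      show "if X = Incr then pa i < pa j else pa j < pa i" if "i \<in> H" "j \<in> H" "i < j" for i j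
        using mono[OF that] neq[OF that] by (auto simp: X_def)
      show "if Y = Incr then pb i < pb j else pb j < pb i" if "i \<in> H" "j \<in> H" "i < j" for i j
        using mono[OF that] neq[OF that] by (auto simp: Y_def)
    qed
    then show False using w p by (auto simp: Av_def)
  qed
  then show ?thesis by blast
qed

theorem theorem5p5:
  fixes B :: "nat list set"
  assumes "\<forall>p\<in>B. cayley_perm p"
  shows "(\<exists>k. Av B \<subseteq> HSB k) \<longleftrightarrow>
    (\<exists>p\<in>B. p \<in> Hclass Incr Incr) \<and> (\<exists>p\<in>B. p \<in> Hclass Incr Decr) \<and>
    (\<exists>p\<in>B. p \<in> Hclass Decr Incr) \<and> (\<exists>p\<in>B. p \<in> Hclass Decr Decr)"
proof
  assume "\<exists>k. Av B \<subseteq> HSB k"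
  then show "(\<exists>p\<in>B. p \<in> Hclass Incr Incr) \<and> (\<exists>p\<in>B. p \<in> Hclass Incr Decr) \<and>
    (\<exists>p\<in>B. p \<in> Hclass Decr Incr) \<and> (\<exists>p\<in>B. p \<in> Hclass Decr Decr)"
    using Av_bounded_imp_Hclass by blast
next
  assume "(\<exists>p\<in>B. p \<in> Hclass Incr Incr) \<and> (\<exists>p\<in>B. p \<in> Hclass Incr Decr) \<and>
    (\<exists>p\<in>B. p \<in> Hclass Decr Incr) \<and> (\<exists>p\<in>B. p \<in> Hclass Decr Decr)"
  then have "\<exists>p\<in>B. p \<in> Hclass X Y" for X Y
    by (cases X; cases Y) auto
  then show "\<exists>k. Av B \<subseteq> HSB k" by (rule Hclass_imp_Av_bounded)
qed

end
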